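(* Let $F$ be a field, let $n\ge2$, and let $A=(a_{ij})_{n\times n}$ be an $n\times n$ matrix over $F$. Then for all $1\le i,j\le n$ with $i\ne j$, $$M_{ii}M_{jj}-M_{ij}M_{ji}=M_{i\,j}^{i\,j}\,\det A.$$
   Context: $M_{ij}$ denotes the cofactor (minor, with no sign factor) of the entry $a_{ij}$ of $A$, i.e. the determinant of the $(n-1)\times(n-1)$ matrix obtained from $A$ by deleting row $i$ and column $j$. For $i\neq j$, $M_{i\,j}^{i\,j}$ denotes the determinant of the $(n-2)\times(n-2)$ matrix obtained from $A$ by deleting rows $i,j$ and columns $i,j$; the determinant of the empty ($0\times0$) matrix is $1$. *)

theory Defs
  imports
    "Jordan_Normal_Form.Determinant"
    "Jordan_Normal_Form.DL_Submatrix"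
begin

text \<open>Matrices are indexed from 0, so rows and columns \<open>1, \<dots>, n\<close> are \<open>0, \<dots>, n - 1\<close> here.
  The minor is unsigned, unlike the library's \<^const>\<open>cofactor\<close>.\<close>

definition minor :: "'a::comm_ring_1 mat \<Rightarrow> nat \<Rightarrow> nat \<Rightarrow> 'a" where
  "minor A i j = det (mat_delete A i j)"

text \<open>\<^const>\<open>submatrix\<close> takes the index sets that are kept, hence the complements; indices
  beyond the dimensions of \<open>A\<close> are ignored, and the determinant of the empty matrix is \<open>1\<close>.\<close>

definition principal_minor2 :: "'a::comm_ring_1 mat \<Rightarrow> nat \<Rightarrow> nat \<Rightarrow> 'a" where
  "principal_minor2 A i j = det (submatrix A (- {i, j}) (- {i, j}))"

end

theory Submission
  imports Defs
begin

text \<open>The idea is to compute one determinant by multilinearity in its columns. Write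
  \<open>C k l\<close> for the signed cofactor at row \<open>k\<close> and column \<open>l\<close>, \<open>a k\<close> for the columns of \<open>A\<close> and
  \<open>e k\<close> for the unit vectors. Row \<open>j\<close> of the cofactor matrix is column \<open>j\<close> of the adjugate, so
  \<open>det A * e j = (\<Sum>k. C j k * a k)\<close>.
  Replace column \<open>i\<close> of \<open>A\<close> by \<open>e i\<close>, put either side of this equation into column \<open>j\<close>, and take the determinant.
  On the left the result is \<open>det A\<close> times the determinant of \<open>A\<close> with both columns replaced by
  unit vectors, which is the doubly deleted minor. On the right only two summands survive,
  since for every other \<open>k\<close> the vector \<open>a k\<close> is already one of the columns: \<open>k = j\<close> gives
  \<open>C j j * C i i\<close>, and \<open>k = i\<close> gives, after exchanging columns \<open>i\<close> and \<open>j\<close>, the product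
  \<open>- C j i * C i j\<close>. This is \<open>cofactor_product_diff_eq\<close>.

  Nothing is divided, so the argument runs over commutative rings and treats singular and
  invertible matrices alike. The signs disappear, because \<open>C i j\<close> and \<open>C j i\<close> carry the same
  sign. Finally, as the identity is symmetric in \<open>i\<close> and \<open>j\<close>, one may take \<open>i < j\<close>.\<close>

lemma replace_col_carrier [simp]:
  "A \<in> carrier_mat m n \<Longrightarrow> replace_col A b k \<in> carrier_mat m n"
  by (auto simp: replace_col_def)

lemma cofactor_replace_col:
  assumes "A \<in> carrier_mat n n" and "r < n" and "k < n"
  shows "cofactor (replace_col A b k) r k = cofactor A r k"
proof -
  have "mat_delete (replace_col A b k) r k = mat_delete A r k"
    using assms by (auto simp: mat_delete_def replace_col_def)
  then show ?thesis by (simp add: cofactor_def)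
qed

lemma det_replace_col:
  fixes A :: "'a::comm_ring_1 mat"
  assumes A: "A \<in> carrier_mat n n" and k: "k < n"
  shows "det (replace_col A b k) = (\<Sum>r<n. b $ r * cofactor A r k)"
proof -
  have "det (replace_col A b k)
      = (\<Sum>r<n. replace_col A b k $$ (r, k) * cofactor (replace_col A b k) r k)"
    by (rule laplace_expansion_column) (use A k in auto)
  also have "\<dots> = (\<Sum>r<n. b $ r * cofactor A r k)"
    using A k by (intro sum.cong) (auto simp: cofactor_replace_col, auto simp: replace_col_def)
  finally show ?thesis .
qed

lemma det_replace_col_unit_vec:
  fixes A :: "'a::comm_ring_1 mat"
  assumes A: "A \<in> carrier_mat n n" and r: "r < n" and k: "k < n"
  shows "det (replace_col A (unit_vec n r) k) = cofactor A r k"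
proof -
  have "det (replace_col A (unit_vec n r) k) = (\<Sum>s<n. if s = r then cofactor A r k else 0)"
    unfolding det_replace_col[OF A k] using r by (intro sum.cong) auto
  then show ?thesis using r by simp
qed

text \<open>Replacing column \<open>i\<close> by \<open>b\<close> and moving the old column \<open>i\<close> to position \<open>j\<close> is the same,
  up to an exchange of two columns, as replacing column \<open>j\<close> by \<open>b\<close>.\<close>

lemma det_replace_col_move:
  fixes A :: "'a::comm_ring_1 mat"
  assumes A: "A \<in> carrier_mat n n" and i: "i < n" and j: "j < n" and ij: "i \<noteq> j"
  shows "det (replace_col (replace_col A b i) (col A i) j) = - det (replace_col A b j)"
proof -
  have "replace_col (replace_col A b i) (col A i) j = swapcols i j (replace_col A b j)"
    using A i j ij by (intro eq_matI) (auto simp: replace_col_def mat_swapcols_def)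
  then show ?thesis
    using det_swapcols[OF i j ij replace_col_carrier[OF A]] by simp
qed

lemma cofactor_row_combination:
  fixes A :: "'a::comm_ring_1 mat"
  assumes A: "A \<in> carrier_mat n n" and r: "r < n" and j: "j < n"
  shows "(\<Sum>k<n. A $$ (r, k) * cofactor A j k) = (if r = j then det A else 0)"
proof -
  have "(\<Sum>k<n. A $$ (r, k) * cofactor A j k) = (A * adj_mat A) $$ (r, j)"
    using A r j by (auto simp: adj_mat_def scalar_prod_def lessThan_atLeast0 intro!: sum.cong)
  also have "\<dots> = (if r = j then det A else 0)"
    using adj_mat(2)[OF A] r j by simp
  finally show ?thesis .
qed

text \<open>Cramer's rule for \<open>B\<close>, which is \<open>A\<close> with column \<open>i\<close> replaced by a unit vector, performs
  the expansion over \<open>k\<close>. The vector \<open>x\<close> is row \<open>j\<close> of the cofactor matrix without its entry at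
  \<open>i\<close>; hence \<open>B *\<^sub>v x\<close> is \<open>det A\<close> times the unit vector at \<open>j\<close>, less the multiple of
  column \<open>i\<close> of \<open>A\<close> that was dropped.\<close>

lemma cofactor_product_diff_eq:
  fixes A :: "'a::comm_ring_1 mat"
  assumes A: "A \<in> carrier_mat n n" and i: "i < n" and j: "j < n" and ij: "i \<noteq> j"
  shows "cofactor A i i * cofactor A j j - cofactor A i j * cofactor A j i
    = det A * cofactor (replace_col A (unit_vec n i) i) j j"
proof -
  define B where "B = replace_col A (unit_vec n i) i"
  \<comment> \<open>The entry at \<open>i\<close> is set to zero, so that \<open>B\<close> and \<open>A\<close> act on \<open>x\<close> in the same way.\<close>
  define x where "x = vec n (\<lambda>k. if k = i then 0 else cofactor A j k)"
  have B: "B \<in> carrier_mat n n" using A by (simp add: B_def)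
  have x: "x \<in> carrier_vec n" by (simp add: x_def)
  have Bx: "(B *\<^sub>v x) $ r = (if r = j then det A else 0) - cofactor A j i * A $$ (r, i)"
    if r: "r < n" for r
  proof -
    have "(B *\<^sub>v x) $ r = (\<Sum>k<n. B $$ (r, k) * x $ k)"
      using B x r by (auto simp: scalar_prod_def lessThan_atLeast0 intro!: sum.cong)
    also have "\<dots> = (\<Sum>k<n. A $$ (r, k) * cofactor A j k
        - (if k = i then A $$ (r, i) * cofactor A j i else 0))"
      using A r by (intro sum.cong) (auto simp: B_def x_def replace_col_def)
    also have "\<dots> = (if r = j then det A else 0) - cofactor A j i * A $$ (r, i)"
      using i cofactor_row_combination[OF A r j] by (simp add: sum_subtractf mult.commute)
    finally show ?thesis .
  qed
  have "cofactor A i i * cofactor A j j = x $ j * det B"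
    using ij j det_replace_col_unit_vec[OF A i i] by (simp add: x_def B_def mult.commute)
  also have "\<dots> = det (replace_col B (B *\<^sub>v x) j)"
    using cramer_lemma_mat[OF B x j] by simp
  also have "\<dots> = (\<Sum>r<n. (B *\<^sub>v x) $ r * cofactor B r j)"
    by (rule det_replace_col[OF B j])
  also have "\<dots> = (\<Sum>r<n. (if r = j then det A * cofactor B j j else 0)
      - cofactor A j i * (col A i $ r * cofactor B r j))"
    using A i by (intro sum.cong) (auto simp: Bx algebra_simps)
  also have "\<dots> = det A * cofactor B j j - cofactor A j i * det (replace_col B (col A i) j)"
    using j by (simp add: sum_subtractf det_replace_col[OF B j] sum_distrib_left)
  also have "det (replace_col B (col A i) j) = - cofactor A i j"
    using det_replace_col_move[OF A i j ij] det_replace_col_unit_vec[OF A i j]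
    by (simp add: B_def)
  finally show ?thesis by (simp add: B_def algebra_simps)
qed

text \<open>A member \<open>m\<close> of a set of naturals has position \<open>k\<close> when exactly \<open>k\<close> members lie below \<open>m\<close>,
  so the claim is verified by counting.\<close>

lemma pick_Compl_two:
  fixes i j k :: nat
  assumes "i < j"
  shows "pick (- {i, j}) k = (if k < i then k else if Suc k < j then Suc k else Suc (Suc k))"
    (is "_ = ?m")
proof -
  have m: "?m \<in> - {i, j}" using assms by auto
  have "card {a \<in> - {i, j}. a < ?m} = k"
  proof -
    consider "k < i" | "i \<le> k" "Suc k < j" | "i \<le> k" "j \<le> Suc k" by linarith
    then show ?thesis
    proof cases
      case 1
      then have "{a \<in> - {i, j}. a < ?m} = {..<k}" using assms by auto
      then show ?thesis by simp
    next
      case 2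
      then have "{a \<in> - {i, j}. a < ?m} = {..<Suc k} - {i}" by auto
      then show ?thesis using 2 by simp
    next
      case 3
      then have "{a \<in> - {i, j}. a < ?m} = {..<Suc (Suc k)} - {i, j}" by auto
      then show ?thesis using 3 assms by (simp add: card_Diff_subset)
    qed
  qed
  then show ?thesis using pick_card_in_set[OF m] by simp
qed

text \<open>Deleting the larger index first leaves the smaller one unshifted.\<close>

lemma submatrix_delete_two:
  assumes A: "A \<in> carrier_mat n n" and ij: "i < j" and j: "j < n"
  shows "submatrix A (- {i, j}) (- {i, j}) = mat_delete (mat_delete A j j) i i"
proof -
  have "{k. k < n \<and> k \<in> - {i, j}} = {..<n} - {i, j}" by auto
  then have card: "card {k. k < n \<and> k \<in> - {i, j}} = n - 2"
    using ij j by (simp add: card_Diff_subset)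
  show ?thesis
  proof (rule eq_matI)
    fix r s
    assume "r < dim_row (mat_delete (mat_delete A j j) i i)"
      and "s < dim_col (mat_delete (mat_delete A j j) i i)"
    then have rs: "r < n - 2" "s < n - 2" using A by auto
    then have "submatrix A (- {i, j}) (- {i, j}) $$ (r, s)
        = A $$ (pick (- {i, j}) r, pick (- {i, j}) s)"
      using A card by (intro submatrix_index) auto
    then show "submatrix A (- {i, j}) (- {i, j}) $$ (r, s)
        = mat_delete (mat_delete A j j) i i $$ (r, s)"
      using A ij rs by (auto simp: pick_Compl_two[OF ij] mat_delete_def)
  qed (use A card in \<open>auto simp: dim_submatrix\<close>)
qed

text \<open>The cofactor deletes row and column \<open>j\<close>. Column \<open>i\<close> of what remains is still a unit vector,
  so expanding along it deletes row and column \<open>i\<close> as well.\<close>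

lemma cofactor_replace_col_unit_vec:
  fixes A :: "'a::comm_ring_1 mat"
  assumes A: "A \<in> carrier_mat n n" and ij: "i < j" and j: "j < n"
  shows "cofactor (replace_col A (unit_vec n i) i) j j = principal_minor2 A i j"
proof -
  have D: "mat_delete A j j \<in> carrier_mat (n - 1) (n - 1)"
    by (rule mat_delete_carrier[OF A])
  have "mat_delete (replace_col A (unit_vec n i) i) j j
      = replace_col (mat_delete A j j) (unit_vec (n - 1) i) i"
    using A ij j by (intro eq_matI) (auto simp: mat_delete_def replace_col_def)
  moreover have "det (replace_col (mat_delete A j j) (unit_vec (n - 1) i) i)
      = cofactor (mat_delete A j j) i i"
    by (rule det_replace_col_unit_vec[OF D]) (use ij j in auto)
  ultimately show ?thesis
    by (simp add: cofactor_def principal_minor2_def submatrix_delete_two[OF A ij j])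
qed

lemma minor_product_diff_eq:
  fixes A :: "'a::comm_ring_1 mat"
  assumes A: "A \<in> carrier_mat n n" and ij: "i < j" and j: "j < n"
  shows "minor A i i * minor A j j - minor A i j * minor A j i = principal_minor2 A i j * det A"
proof -
  have "cofactor A i j * cofactor A j i = (-1) ^ (i + j + (j + i)) * (minor A i j * minor A j i)"
    by (simp only: cofactor_def minor_def power_add mult_ac)
  moreover have "even (i + j + (j + i))" by auto
  ultimately have "cofactor A i j * cofactor A j i = minor A i j * minor A j i"
    by (simp only: neg_one_even_power mult_1)
  then show ?thesis
    using cofactor_product_diff_eq[OF A _ j, of i] cofactor_replace_col_unit_vec[OF A ij j] ij j
    by (simp add: cofactor_def minor_def mult.commute)
qed

theorem theorem3p4:
  fixes A :: "'a::field mat" and n i j :: nat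
  assumes "n \<ge> 2"
    and "A \<in> carrier_mat n n"
    and "i < n" and "j < n" and "i \<noteq> j"
  shows "minor A i i * minor A j j - minor A i j * minor A j i = principal_minor2 A i j * det A"
proof (cases "i < j")
  case True
  then show ?thesis using assms by (intro minor_product_diff_eq)
next
  case False
  then have "minor A j j * minor A i i - minor A j i * minor A i j = principal_minor2 A j i * det A"
    using assms by (intro minor_product_diff_eq) auto
  then show ?thesis
    by (simp add: principal_minor2_def insert_commute mult.commute)
qed

end
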